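(* For every $k\in\mathbb{N}$ with $k\geq 2$, the proportion of good vertices in the graph $B(k)$ equals $\frac{2k}{5k+6}$.
   Context: All graphs are finite and simple. For a connected graph $G=(V,E)$, $d_G(x,y)$ denotes the length of a shortest path from $x$ to $y$, and the Wiener index is $W(G)=\frac12\sum_{u,v\in V,\,u\neq v} d_G(u,v)$ (the sum over ordered pairs, so each unordered pair of distinct vertices contributes its distance once). $G-v$ is the graph obtained from $G$ by removing the vertex $v$. A vertex $v\in V$ is called good if $G-v$ is connected and $W(G)=W(G-v)$. The proportion of good vertices in $G$ is the number of good vertices of $G$ divided by $|V|$. Definition of $B(k)$ for $k\in\mathbb{N}$, $k>1$: take a path of length $5$ with consecutive vertices $w_0,w_1,w_2,w_3,w_4,w_5$. Take $k$ pairwise disjoint paths $(v_{i1},v_{i2},v_{i3},v_{i4},v_{i5})$, $i\in\{1,\dots,k\}$, also disjoint from the first path. For each $i\in\{1,\dots,k\}$ add the edges $\{w_0,v_{i1}\}$ and $\{w_5,v_{i5}\}$. The resulting graph $B(k)$ has $5k+6$ vertices. *)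

theory Defs
  imports "Graph_Theory.Graph_Theory"
begin

text \<open>
  A finite simple graph is a digraph satisfying the locale \<^locale>\<open>graph\<close>: it is finite, loop-free and
  without parallel arcs, and its arc set is symmetric, so that each undirected edge is represented
  by its two orientations.
\<close>

text \<open>Only meaningful when \<open>y\<close> is reachable from \<open>x\<close>; otherwise the set under \<open>LEAST\<close> is empty and
  the value is unspecified.\<close>

definition graph_dist :: "('a, 'b) pre_digraph \<Rightarrow> 'a \<Rightarrow> 'a \<Rightarrow> nat" where
  "graph_dist G x y = (LEAST n. \<exists>p. pre_digraph.apath G x p y \<and> length p = n)"

text \<open>Only meaningful for connected graphs.\<close>

definition wiener_index :: "('a, 'b) pre_digraph \<Rightarrow> real" where
  "wiener_index G =
     1 / 2 * (\<Sum>(u, v) \<in> {(u, v). u \<in> verts G \<and> v \<in> verts G \<and> u \<noteq> v}. real (graph_dist G u v))"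

text \<open>The graph \<open>G\<close> itself is understood to be connected.\<close>

definition good_vertex :: "('a, 'b) pre_digraph \<Rightarrow> 'a \<Rightarrow> bool" where
  "good_vertex G v \<longleftrightarrow>
     v \<in> verts G \<and>
     Digraph_Component.connected (pre_digraph.del_vert G v) \<and>
     wiener_index G = wiener_index (pre_digraph.del_vert G v)"

definition good_proportion :: "('a, 'b) pre_digraph \<Rightarrow> real" where
  "good_proportion G = real (card {v. good_vertex G v}) / real (card (verts G))"

text \<open>\<open>PathW j\<close> is the vertex \<open>w\<^sub>j\<close> and \<open>PathV i j\<close> is the vertex \<open>v\<^sub>i\<^sub>j\<close>.\<close>

datatype B_vertex = PathW nat | PathV nat nat

definition B_graph :: "nat \<Rightarrow> B_vertex pair_pre_digraph" where
  "B_graph k =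
     \<lparr> pverts = {PathW j | j. j \<in> {0..5}} \<union> {PathV i j | i j. i \<in> {1..k} \<and> j \<in> {1..5}},
       parcs = symcl
         ({(PathW j, PathW (j + 1)) | j. j \<in> {0..<5}} \<union>
          {(PathV i j, PathV i (j + 1)) | i j. i \<in> {1..k} \<and> j \<in> {1..<5}} \<union>
          {(PathW 0, PathV i 1) | i. i \<in> {1..k}} \<union>
          {(PathW 5, PathV i 5) | i. i \<in> {1..k}}) \<rparr>"

lemma pverts_B_graph_eq:
  "pverts (B_graph k) = PathW ` {0..5} \<union> (\<lambda>(i, j). PathV i j) ` ({1..k} \<times> {1..5})"
  by (auto simp: B_graph_def)

lemma card_pverts_B_graph: "card (pverts (B_graph k)) = 5 * k + 6"
proof -
  have "card (PathW ` {0..5}) = 6"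
    by (subst card_image) (auto simp: inj_on_def)
  moreover have "card ((\<lambda>(i, j). PathV i j) ` ({1..k} \<times> {1..5})) = 5 * k"
    by (subst card_image) (auto simp: inj_on_def)
  ultimately show ?thesis
    unfolding pverts_B_graph_eq by (subst card_Un_disjoint) auto
qed

lemma pair_graph_B_graph: "pair_graph (B_graph k)"
proof -
  have sub: "parcs (B_graph k) \<subseteq> pverts (B_graph k) \<times> pverts (B_graph k)"
    by (auto simp: B_graph_def symcl_def)
  have fin: "finite (pverts (B_graph k))"
    unfolding pverts_B_graph_eq by auto
  have "finite (parcs (B_graph k))"
    using finite_subset[OF sub] fin by auto
  moreover have "sym (parcs (B_graph k))"
    by (auto simp: B_graph_def symcl_def sym_def)
  moreover have "fst e \<noteq> snd e" if "e \<in> parcs (B_graph k)" for e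
    using that by (auto simp: B_graph_def symcl_def)
  ultimately show ?thesis
    using sub fin by unfold_locales (auto simp: symmetric_def)
qed

lemma connected_B_graph:
  "Digraph_Component.connected (B_graph k)"
proof -
  interpret pair_graph "B_graph k" by (rule pair_graph_B_graph)
  have step: "PathW 0 \<rightarrow>\<^sup>*\<^bsub>B_graph k\<^esub> y"
    if "PathW 0 \<rightarrow>\<^sup>*\<^bsub>B_graph k\<^esub> x" "(x, y) \<in> parcs (B_graph k)" for x y
    using that by (meson reachable_adjI reachable_trans)
  have w: "PathW 0 \<rightarrow>\<^sup>*\<^bsub>B_graph k\<^esub> PathW j" if "j \<le> 5" for j
    using that
  proof (induction j)
    case 0
    show ?case by (rule reachable_refl) (auto simp: B_graph_def)
  next
    case (Suc j)
    have "(PathW j, PathW (Suc j)) \<in> parcs (B_graph k)"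
      using Suc.prems by (auto simp: B_graph_def symcl_def)
    with Suc show ?case by (auto intro: step)
  qed
  have v: "PathW 0 \<rightarrow>\<^sup>*\<^bsub>B_graph k\<^esub> PathV i (Suc j)" if "i \<in> {1..k}" "j < 5" for i j
    using that(2)
  proof (induction j)
    case 0
    have "(PathW 0, PathV i (Suc 0)) \<in> parcs (B_graph k)"
      using that(1) by (auto simp: B_graph_def symcl_def)
    with w[of 0] show ?case by (auto intro: step)
  next
    case (Suc j)
    have "(PathV i (Suc j), PathV i (Suc (Suc j))) \<in> parcs (B_graph k)"
      using Suc.prems that(1) by (auto simp: B_graph_def symcl_def)
    with Suc show ?case by (auto intro: step)
  qed
  have from_w0: "PathW 0 \<rightarrow>\<^sup>*\<^bsub>B_graph k\<^esub> x" if "x \<in> pverts (B_graph k)" for x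
  proof (cases x)
    case (PathW j)
    with that w show ?thesis by (auto simp: B_graph_def)
  next
    case (PathV i j)
    with that have "i \<in> {1..k}" "j - 1 < 5" "j = Suc (j - 1)" by (auto simp: B_graph_def)
    with v[of i "j - 1"] PathV show ?thesis by simp
  qed
  have "x \<rightarrow>\<^sup>*\<^bsub>B_graph k\<^esub> y" if "x \<in> pverts (B_graph k)" "y \<in> pverts (B_graph k)" for x y
    using that from_w0 symmetric_reachable[OF sym_arcs] reachable_trans by blast
  moreover have "(arcs_ends (with_proj (B_graph k)))\<^sup>s = arcs_ends (with_proj (B_graph k))"
    using sym_arcs by (auto simp: symmetric_def symcl_def sym_def)
  moreover have "pverts (B_graph k) \<noteq> {}"
    by (auto simp: B_graph_def)
  ultimately show ?thesis
    by (auto simp: connected_conv reachable_def)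
qed

end

theory Submission
  imports Defs
begin

text \<open>
  In \<open>B(k)\<close> the path \<open>w\<^sub>0, \<dots>, w\<^sub>5\<close> forms a cycle of length 11 with each of the attached strands
  \<open>v\<^sub>i\<^sub>1, \<dots>, v\<^sub>i\<^sub>5\<close>, and distances in this cycle are distances in \<open>B(k)\<close>. The cycle of length 11 has
  Wiener index 165, and so has the path with 10 vertices that is left when a vertex of the cycle is
  deleted. Therefore, when a vertex \<open>x\<close> is deleted, the distances within one such cycle through \<open>x\<close>
  contribute nothing to the change of the Wiener index, and the change is caused by the remaining
  \<open>k - 1\<close> strands. It equals \<open>k - 1\<close> times

    \<^item> \<open>0\<close> for \<open>v\<^sub>i\<^sub>1, v\<^sub>i\<^sub>5\<close>, \<open>-15\<close> for \<open>v\<^sub>i\<^sub>2, v\<^sub>i\<^sub>4\<close>, and \<open>-20\<close> for \<open>v\<^sub>i\<^sub>3\<close>;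

    \<^item> \<open>20 k + 15\<close> for \<open>w\<^sub>0, w\<^sub>5\<close>, \<open>-5\<close> for \<open>w\<^sub>1, w\<^sub>4\<close>, and \<open>-15\<close> for \<open>w\<^sub>2, w\<^sub>3\<close>.

  No vertex is a cut vertex, so for \<open>k \<ge> 2\<close> the good vertices are exactly the \<open>2 k\<close> vertices \<open>v\<^sub>i\<^sub>1\<close>
  and \<open>v\<^sub>i\<^sub>5\<close>.

  The proof needs the distances in \<open>B(k) - x\<close> for every \<open>x\<close>. They are given by one explicit formula,
  \<open>B_dist\<close>, which is verified locally by means of \<open>graph_dist_certificate\<close>. The lemma
  \<open>sum_B_graph_by_blocks\<close> reduces the Wiener index to the sums of these distances over pairs of
  strands. Such a sum does not depend on \<open>k\<close> and is evaluated numerically; this gives the changes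
  listed above in \<open>wiener_index_B_minus_PathW\<close> and \<open>wiener_index_B_minus_PathV\<close>.
\<close>

section \<open>Certifying distances in a digraph\<close>

text \<open>
  A guessed distance function \<open>f\<close> to a fixed target is verified by two local conditions. A function
  that drops by at most one along every arc is a lower bound for the length of any walk to the
  target. If moreover every vertex other than the target has an out-neighbour where \<open>f\<close> is smaller by
  one, then descending along such arcs gives a walk of length \<open>f u\<close>, and it repeats no vertex because
  \<open>f\<close> strictly decreases.
\<close>
lemma (in wf_digraph) graph_dist_certificate:
  fixes f :: "'a \<Rightarrow> nat"
  assumes target: "v \<in> verts G" "f v = 0"
    and lipschitz: "\<And>a b. a \<rightarrow>\<^bsub>G\<^esub> b \<Longrightarrow> f a \<le> f b + 1"
    and closer: "\<And>a. a \<in> verts G \<Longrightarrow> a \<noteq> v \<Longrightarrow> \<exists>b. a \<rightarrow>\<^bsub>G\<^esub> b \<and> f a = f b + 1"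
    and u: "u \<in> verts G"
  shows "graph_dist G u v = f u" "u \<rightarrow>\<^sup>*\<^bsub>G\<^esub> v"
proof -
  \<comment> \<open>The bound on \<open>f\<close> along the path is what keeps the next prepended vertex off the path.\<close>
  have "\<exists>p. apath u p v \<and> length p = f u \<and> (\<forall>w \<in> set (awalk_verts u p). f w \<le> f u)"
    using u
  proof (induction "f u" arbitrary: u)
    case 0
    then have "u = v" using closer by fastforce
    then show ?case using target by (intro exI[of _ "[]"]) (simp add: apath_Nil_iff)
  next
    case (Suc n)
    then have "u \<noteq> v" using target by auto
    with closer Suc.prems obtain w where w: "u \<rightarrow>\<^bsub>G\<^esub> w" "f u = f w + 1" by blast
    then have "w \<in> verts G" "n = f w" using Suc.hyps(2) by auto
    with Suc.hyps(1) obtain p where p: "apath w p v" "length p = f w"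
        "\<forall>x \<in> set (awalk_verts w p). f x \<le> f w" by blast
    from w(1) obtain e where e: "e \<in> arcs G" "tail G e = u" "head G e = w" by auto
    have "u \<notin> set (awalk_verts w p)" using p(3) w(2) by auto
    then have "apath u (e # p) v" using p(1) e by (simp add: apath_Cons_iff)
    then show ?case using p(2,3) e w(2) by (intro exI[of _ "e # p"]) auto
  qed
  then obtain p where p: "apath u p v" "length p = f u" by blast
  have lower: "f u \<le> length q" if "awalk u q v" for u q
    using that
  proof (induction q arbitrary: u)
    case Nil
    then show ?case using target by (simp add: awalk_Nil_iff)
  next
    case (Cons e q)
    then have e: "e \<in> arcs G" "u = tail G e" "awalk (head G e) q v"
      by (simp_all add: awalk_Cons_iff)
    then have "f u \<le> f (head G e) + 1" using lipschitz in_arcs_imp_in_arcs_ends by blast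
    with Cons.IH[OF e(3)] show ?case by simp
  qed
  show "graph_dist G u v = f u"
    unfolding graph_dist_def
    using p lower by (intro Least_equality) (auto intro: awalkI_apath)
  show "u \<rightarrow>\<^sup>*\<^bsub>G\<^esub> v" using p(1) reachable_apath by blast
qed

section \<open>Distances after deletion of a vertex\<close>

text \<open>
  The graph \<open>B(k)\<close> is treated as a bundle of strands between the hubs \<open>w\<^sub>0\<close> and \<open>w\<^sub>5\<close>: the strand
  \<open>None\<close> is the path \<open>w\<^sub>0, \<dots>, w\<^sub>5\<close>, hubs included, and the strand \<open>Some i\<close> consists of the five
  vertices \<open>v\<^sub>i\<^sub>1, \<dots>, v\<^sub>i\<^sub>5\<close>.
\<close>
fun strand :: "B_vertex \<Rightarrow> nat option" where
  "strand (PathW m) = None"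
| "strand (PathV i j) = Some i"

text \<open>
  The offsets are the lengths of the routes to \<open>w\<^sub>0\<close> and \<open>w\<^sub>5\<close> within the vertex's own strand. The
  predicates \<open>cut_from_w0 x\<close> and \<open>cut_from_w5 x\<close> below say that the deletion of \<open>x\<close> destroys these
  routes; this includes the case that \<open>x\<close> is the hub itself.
\<close>
fun w0_offset :: "B_vertex \<Rightarrow> nat" where
  "w0_offset (PathW m) = m"
| "w0_offset (PathV i j) = j"

fun w5_offset :: "B_vertex \<Rightarrow> nat" where
  "w5_offset (PathW m) = 5 - m"
| "w5_offset (PathV i j) = 6 - j"

fun cut_from_w0 :: "B_vertex \<Rightarrow> B_vertex \<Rightarrow> bool" where
  "cut_from_w0 (PathW c) (PathW m) = (c < m)"
| "cut_from_w0 (PathW c) (PathV i j) = (c = 0)"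
| "cut_from_w0 (PathV a c) (PathW m) = False"
| "cut_from_w0 (PathV a c) (PathV i j) = (a = i \<and> c < j)"

fun cut_from_w5 :: "B_vertex \<Rightarrow> B_vertex \<Rightarrow> bool" where
  "cut_from_w5 (PathW c) (PathW m) = (m < c)"
| "cut_from_w5 (PathW c) (PathV i j) = (c = 5)"
| "cut_from_w5 (PathV a c) (PathW m) = False"
| "cut_from_w5 (PathV a c) (PathV i j) = (a = i \<and> j < c)"

text \<open>
  Two vertices of different strands lie on a cycle through both hubs, and a shortest path is one of
  the two arcs of that cycle; deleting a vertex on one arc forces the other one. Two vertices of the
  same strand are joined along the strand, unless \<open>x\<close> lies between them, which is the case exactly
  if \<open>x\<close> cuts off just one of them from \<open>w\<^sub>0\<close>. The detour then uses the rest of a cycle of length 11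
  formed by the path of the \<open>w\<^sub>j\<close> and one of the strands \<open>Some i\<close>.
\<close>
definition B_dist :: "B_vertex \<Rightarrow> B_vertex \<Rightarrow> B_vertex \<Rightarrow> nat" where
  "B_dist x u v =
    (if strand u = strand v then
       (let d = (w0_offset u - w0_offset v) + (w0_offset v - w0_offset u)
        in if cut_from_w0 x u = cut_from_w0 x v then d else 11 - d)
     else if cut_from_w0 x u \<or> cut_from_w0 x v then w5_offset u + w5_offset v
     else if cut_from_w5 x u \<or> cut_from_w5 x v then w0_offset u + w0_offset v
     else min (w0_offset u + w0_offset v) (w5_offset u + w5_offset v))"

lemma B_dist_commute: "B_dist x u v = B_dist x v u"
  by (auto simp: B_dist_def Let_def)

text \<open>
  Positions are listed as numerals, so that distances between explicit positions can be evaluated by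
  simplification, while the strand number stays symbolic.
\<close>
lemma B_vertex_cases:
  assumes "u \<in> pverts (B_graph k)"
  obtains (W) m where "u = PathW m" "m \<in> {0, 1, 2, 3, 4, 5}"
        | (V) i j where "u = PathV i j" "i \<in> {1..k}" "j \<in> {1, 2, 3, 4, 5}"
  using assms by (auto simp: B_graph_def numeral_eq_Suc le_Suc_eq)

text \<open>One of the two orientations of each edge, running from \<open>w\<^sub>0\<close> towards \<open>w\<^sub>5\<close> except at \<open>w\<^sub>5\<close>.\<close>
definition B_edge :: "nat \<Rightarrow> B_vertex \<Rightarrow> B_vertex \<Rightarrow> bool" where
  "B_edge k a b \<longleftrightarrow>
    (\<exists>m<5. a = PathW m \<and> b = PathW (Suc m)) \<or>
    (\<exists>i\<in>{1..k}. \<exists>j\<in>{1..<5}. a = PathV i j \<and> b = PathV i (Suc j)) \<or>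
    (\<exists>i\<in>{1..k}. a = PathW 0 \<and> b = PathV i 1) \<or>
    (\<exists>i\<in>{1..k}. a = PathW 5 \<and> b = PathV i 5)"

lemma parcs_B_graph_iff: "(a, b) \<in> parcs (B_graph k) \<longleftrightarrow> B_edge k a b \<or> B_edge k b a"
  by (auto simp: B_graph_def symcl_def B_edge_def)

text \<open>
  A step along a strand that does not meet \<open>x\<close> changes neither of the two cut predicates, and so it
  keeps the branch taken in the definition of the distance.
\<close>
lemma B_dist_same_strand_step:
  assumes "strand a = strand b" "cut_from_w0 x a = cut_from_w0 x b" "cut_from_w5 x a = cut_from_w5 x b"
    and "w0_offset b = w0_offset a + 1" "w5_offset a = w5_offset b + 1"
  shows "B_dist x a v \<le> B_dist x b v + 1 \<and> B_dist x b v \<le> B_dist x a v + 1"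
  using assms unfolding B_dist_def Let_def by (auto simp: min_def)

text \<open>
  The neighbours of a vertex in the two directions of its strand. A hub also has neighbours outside
  its strand; the parameter \<open>s\<close> selects the strand that is entered there.
\<close>
fun toward_w0 :: "nat \<Rightarrow> B_vertex \<Rightarrow> B_vertex" where
  "toward_w0 s (PathW m) = (if m = 0 then PathV s 1 else PathW (m - 1))"
| "toward_w0 s (PathV i j) = (if j = 1 then PathW 0 else PathV i (j - 1))"

fun toward_w5 :: "nat \<Rightarrow> B_vertex \<Rightarrow> B_vertex" where
  "toward_w5 s (PathW m) = (if m = 5 then PathV s 5 else PathW (m + 1))"
| "toward_w5 s (PathV i j) = (if j = 5 then PathW 5 else PathV i (j + 1))"

lemma toward_adjacent:
  assumes "u \<in> pverts (B_graph k)" "s \<in> {1..k}"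
  shows "(u, toward_w0 s u) \<in> parcs (B_graph k)" "(u, toward_w5 s u) \<in> parcs (B_graph k)"
proof -
  from assms(1) have "B_edge k u (toward_w0 s u) \<or> B_edge k (toward_w0 s u) u"
    by (cases rule: B_vertex_cases)
       (use assms(2) in \<open>simp only: insert_iff empty_iff simp_thms; elim disjE; simp add: B_edge_def\<close>)+
  then show "(u, toward_w0 s u) \<in> parcs (B_graph k)" by (simp add: parcs_B_graph_iff)
  from assms(1) have "B_edge k u (toward_w5 s u) \<or> B_edge k (toward_w5 s u) u"
    by (cases rule: B_vertex_cases)
       (use assms(2) in \<open>simp only: insert_iff empty_iff simp_thms; elim disjE; simp add: B_edge_def\<close>)+
  then show "(u, toward_w5 s u) \<in> parcs (B_graph k)" by (simp add: parcs_B_graph_iff)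
qed

text \<open>
  The deleted vertex \<open>x\<close> is taken from a graph \<open>B(n)\<close> that may have more strands than \<open>B(k)\<close>. If it
  lies on a strand missing in \<open>B(k)\<close>, nothing is deleted, and so the distances of \<open>B(k)\<close> itself are
  covered as well.
\<close>
lemma B_dist_edge:
  assumes "B_edge k a b" "a \<noteq> x" "b \<noteq> x" "v \<noteq> x" "v \<in> pverts (B_graph k)"
    and x: "x \<in> pverts (B_graph n)"
  shows "B_dist x a v \<le> B_dist x b v + 1 \<and> B_dist x b v \<le> B_dist x a v + 1"
  using assms(1) unfolding B_edge_def
proof (elim disjE exE bexE conjE)
  fix m assume "m < 5" "a = PathW m" "b = PathW (Suc m)"
  then show ?thesis using assms(2-3)
    by (intro B_dist_same_strand_step) (cases x; auto)+
next
  fix i j assume "i \<in> {1..k}" "j \<in> {1..<5}" "a = PathV i j" "b = PathV i (Suc j)"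
  then show ?thesis using assms(2-3)
    by (intro B_dist_same_strand_step) (cases x; auto)+
next
  \<comment> \<open>At the edges that leave a hub the strand changes, and the finitely many combinations of
    positions of \<open>v\<close> and \<open>x\<close> are checked.\<close>
  fix i assume ab: "a = PathW 0" "b = PathV i 1"
  from assms(5) show ?thesis
  proof (cases rule: B_vertex_cases)
    case v: (W m)
    from x show ?thesis
      by (cases rule: B_vertex_cases; insert v(2) assms(2-4); unfold ab v(1);
          simp only: insert_iff empty_iff simp_thms; elim disjE; auto simp: B_dist_def)
  next
    case v: (V i' m)
    from x show ?thesis
      by (cases rule: B_vertex_cases; insert v(3) assms(2-4); unfold ab v(1);
          simp only: insert_iff empty_iff simp_thms; elim disjE; auto simp: B_dist_def)
  qed
next
  fix i assume ab: "a = PathW 5" "b = PathV i 5"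
  from assms(5) show ?thesis
  proof (cases rule: B_vertex_cases)
    case v: (W m)
    from x show ?thesis
      by (cases rule: B_vertex_cases; insert v(2) assms(2-4); unfold ab v(1);
          simp only: insert_iff empty_iff simp_thms; elim disjE; auto simp: B_dist_def)
  next
    case v: (V i' m)
    from x show ?thesis
      by (cases rule: B_vertex_cases; insert v(3) assms(2-4); unfold ab v(1);
          simp only: insert_iff empty_iff simp_thms; elim disjE; auto simp: B_dist_def)
  qed
qed

text \<open>
  One of the two neighbours starts a shortest path. At a hub a strand is entered to reach \<open>v\<close> on that
  strand, or to go round a vertex deleted from the path of the \<open>w\<^sub>j\<close>; in the latter case every strand
  \<open>Some i\<close> is intact, and strand 1 serves as well as any other. As there are only finitely many
  combinations of positions, they are all checked.
\<close>
lemma B_dist_closer: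
  assumes "u \<in> pverts (B_graph k)" "v \<in> pverts (B_graph k)"
    and "u \<noteq> x" "v \<noteq> x" "u \<noteq> v"
    and x: "x \<in> pverts (B_graph n)"
    and s: "s = (case strand v of None \<Rightarrow> 1 | Some i \<Rightarrow> i)"
  shows "(toward_w0 s u \<noteq> x \<and> B_dist x u v = B_dist x (toward_w0 s u) v + 1) \<or>
         (toward_w5 s u \<noteq> x \<and> B_dist x u v = B_dist x (toward_w5 s u) v + 1)"
  using assms(1)
proof (cases rule: B_vertex_cases)
  case u: (W m)
  from assms(2) show ?thesis
  proof (cases rule: B_vertex_cases)
    case v: (W l)
    from x show ?thesis
      by (cases rule: B_vertex_cases; insert u(2) v(2) assms(3-5); unfold s u(1) v(1);
          simp only: insert_iff empty_iff simp_thms; elim disjE; auto simp: B_dist_def)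
  next
    case v: (V i l)
    from x show ?thesis
      by (cases rule: B_vertex_cases; insert u(2) v(3) assms(3-5); unfold s u(1) v(1);
          simp only: insert_iff empty_iff simp_thms; elim disjE; auto simp: B_dist_def)
  qed
next
  case u: (V j m)
  from assms(2) show ?thesis
  proof (cases rule: B_vertex_cases)
    case v: (W l)
    from x show ?thesis
      by (cases rule: B_vertex_cases; insert u(3) v(2) assms(3-5); unfold s u(1) v(1);
          simp only: insert_iff empty_iff simp_thms; elim disjE; auto simp: B_dist_def)
  next
    case v: (V i l)
    from x show ?thesis
      by (cases rule: B_vertex_cases; insert u(3) v(3) assms(3-5); unfold s u(1) v(1);
          simp only: insert_iff empty_iff simp_thms; elim disjE; auto simp: B_dist_def)
  qed
qed

abbreviation B_minus :: "nat \<Rightarrow> B_vertex \<Rightarrow> (B_vertex, B_vertex \<times> B_vertex) pre_digraph" where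
  "B_minus k x \<equiv> pre_digraph.del_vert (with_proj (B_graph k)) x"

lemma verts_B_minus: "verts (B_minus k x) = pverts (B_graph k) - {x}"
  by (simp add: pre_digraph.verts_del_vert)

lemma wf_digraph_B_minus: "wf_digraph (B_minus k x)"
proof -
  interpret pair_graph "B_graph k" by (rule pair_graph_B_graph)
  show ?thesis by (rule wf_digraph_del_vert)
qed

lemma dominates_B_minus:
  "u \<rightarrow>\<^bsub>B_minus k x\<^esub> v \<longleftrightarrow> (u, v) \<in> parcs (B_graph k) \<and> u \<noteq> x \<and> v \<noteq> x"
  by (auto simp: arcs_ends_conv pre_digraph.del_vert_simps)

lemma B_minus_distances:
  assumes k: "k \<ge> 1" and x: "x \<in> pverts (B_graph n)"
    and u: "u \<in> pverts (B_graph k)" "u \<noteq> x" and v: "v \<in> pverts (B_graph k)" "v \<noteq> x"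
  shows "graph_dist (B_minus k x) u v = B_dist x u v" "u \<rightarrow>\<^sup>*\<^bsub>B_minus k x\<^esub> v"
proof -
  interpret wf_digraph "B_minus k x" by (rule wf_digraph_B_minus)
  have v0: "B_dist x v v = 0" by (simp add: B_dist_def)
  have lipschitz: "B_dist x a v \<le> B_dist x b v + 1" if "a \<rightarrow>\<^bsub>B_minus k x\<^esub> b" for a b
    using that B_dist_edge[of k _ _ x v n] v x
    by (auto simp: dominates_B_minus parcs_B_graph_iff)
  have closer: "\<exists>b. a \<rightarrow>\<^bsub>B_minus k x\<^esub> b \<and> B_dist x a v = B_dist x b v + 1"
    if "a \<in> verts (B_minus k x)" "a \<noteq> v" for a
  proof -
    define s where "s = (case strand v of None \<Rightarrow> 1 | Some i \<Rightarrow> i)"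
    have "s \<in> {1..k}" using k v(1) by (cases v) (auto simp: s_def B_graph_def)
    then have "(a, toward_w0 s a) \<in> parcs (B_graph k)" "(a, toward_w5 s a) \<in> parcs (B_graph k)"
      using that toward_adjacent by (auto simp: verts_B_minus)
    moreover note B_dist_closer[of a k v x n s]
    ultimately show ?thesis
      using that v x s_def unfolding dominates_B_minus verts_B_minus by blast
  qed
  show "graph_dist (B_minus k x) u v = B_dist x u v" "u \<rightarrow>\<^sup>*\<^bsub>B_minus k x\<^esub> v"
    using graph_dist_certificate[of v "\<lambda>u. B_dist x u v", OF _ v0 lipschitz closer]
      u v by (auto simp: verts_B_minus)
qed

lemma connected_B_minus:
  assumes "k \<ge> 1" "x \<in> pverts (B_graph n)"
  shows "Digraph_Component.connected (B_minus k x)"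
proof -
  have "(arcs_ends (B_minus k x))\<^sup>s = arcs_ends (B_minus k x)"
  proof (rule set_eqI)
    fix p show "p \<in> (arcs_ends (B_minus k x))\<^sup>s \<longleftrightarrow> p \<in> arcs_ends (B_minus k x)"
      by (cases p) (auto simp: symcl_def dominates_B_minus parcs_B_graph_iff)
  qed
  moreover have "verts (B_minus k x) \<noteq> {}"
  proof -
    have "PathW 0 \<in> pverts (B_graph k)" "PathW 1 \<in> pverts (B_graph k)" by (auto simp: B_graph_def)
    moreover have "PathW 0 \<noteq> x \<or> PathW 1 \<noteq> x" by auto
    ultimately show ?thesis unfolding verts_B_minus by blast
  qed
  ultimately show ?thesis
    using B_minus_distances(2)[OF assms]
    by (auto simp: connected_conv reachable_def verts_B_minus)
qed

section \<open>The Wiener index as a sum over pairs of strands\<close>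

text \<open>
  Setting the distances from and to \<open>x\<close> to zero makes it possible to sum over all vertices of
  \<open>B(k)\<close>, whichever vertex is deleted.
\<close>
definition deleted_dist :: "B_vertex \<Rightarrow> B_vertex \<Rightarrow> B_vertex \<Rightarrow> real" where
  "deleted_dist x u v = (if u = x \<or> v = x then 0 else real (B_dist x u v))"

lemma B_dist_self: "B_dist x u u = 0"
  by (simp add: B_dist_def)

lemma wiener_index_B_minus:
  assumes "k \<ge> 1" "x \<in> pverts (B_graph n)"
  shows "wiener_index (B_minus k x) =
    1 / 2 * (\<Sum>u \<in> pverts (B_graph k). \<Sum>v \<in> pverts (B_graph k). deleted_dist x u v)"
proof -
  let ?V = "pverts (B_graph k)"
  have fin: "finite ?V" by (auto simp: pverts_B_graph_eq)
  have "(\<Sum>(u, v) \<in> {(u, v). u \<in> ?V - {x} \<and> v \<in> ?V - {x} \<and> u \<noteq> v}. real (graph_dist (B_minus k x) u v))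
      = (\<Sum>(u, v) \<in> {(u, v). u \<in> ?V - {x} \<and> v \<in> ?V - {x} \<and> u \<noteq> v}. deleted_dist x u v)"
    using B_minus_distances(1)[OF assms] by (intro sum.cong) (auto simp: deleted_dist_def)
  also have "\<dots> = (\<Sum>(u, v) \<in> ?V \<times> ?V. deleted_dist x u v)"
    using fin by (intro sum.mono_neutral_left) (auto simp: deleted_dist_def B_dist_self split: if_splits)
  finally show ?thesis
    unfolding wiener_index_def verts_B_minus by (simp add: sum.cartesian_product)
qed

definition strand_verts :: "nat option \<Rightarrow> B_vertex set" where
  "strand_verts s = (case s of None \<Rightarrow> PathW ` {0..5} | Some i \<Rightarrow> PathV i ` {1..5})"

lemma sum_strand_verts:
  fixes g :: "B_vertex \<Rightarrow> real"
  shows "sum g (strand_verts None) =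
      g (PathW 0) + g (PathW 1) + g (PathW 2) + g (PathW 3) + g (PathW 4) + g (PathW 5)"
    and "sum g (strand_verts (Some i)) =
      g (PathV i 1) + g (PathV i 2) + g (PathV i 3) + g (PathV i 4) + g (PathV i 5)"
proof -
  have "{0..5} = {0, 1, 2, 3, 4, 5 :: nat}" "{1..5} = {1, 2, 3, 4, 5 :: nat}" by auto
  then show "sum g (strand_verts None) =
      g (PathW 0) + g (PathW 1) + g (PathW 2) + g (PathW 3) + g (PathW 4) + g (PathW 5)"
    and "sum g (strand_verts (Some i)) =
      g (PathV i 1) + g (PathV i 2) + g (PathV i 3) + g (PathV i 4) + g (PathV i 5)"
    by (simp_all add: strand_verts_def)
qed

definition block :: "(B_vertex \<Rightarrow> B_vertex \<Rightarrow> real) \<Rightarrow> nat option \<Rightarrow> nat option \<Rightarrow> real" where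
  "block e s t = (\<Sum>u \<in> strand_verts s. \<Sum>v \<in> strand_verts t. e u v)"

lemma block_commute:
  assumes "\<And>u v. e u v = e v u"
  shows "block e s t = block e t s"
  unfolding block_def by (subst sum.swap) (simp add: assms)

text \<open>
  The deleted vertex meets at most one of the strands \<open>Some i\<close>, which is the strand \<open>a\<close>; the other
  \<open>k - 1\<close> strands are interchangeable. Hence the double sum is a polynomial in \<open>k\<close> whose coefficients
  are sums over blocks whose size does not depend on \<open>k\<close>.
\<close>
lemma sum_B_graph_by_blocks:
  assumes sym: "\<And>u v. e u v = e v u" and a: "a \<in> {1..k}"
    and W: "\<And>i. i \<in> {1..k} \<Longrightarrow> i \<noteq> a \<Longrightarrow> block e None (Some i) = wi"
    and A: "\<And>i. i \<in> {1..k} \<Longrightarrow> i \<noteq> a \<Longrightarrow> block e (Some a) (Some i) = ai"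
    and same: "\<And>i. i \<in> {1..k} \<Longrightarrow> i \<noteq> a \<Longrightarrow> block e (Some i) (Some i) = ii"
    and diff: "\<And>i j. i \<in> {1..k} \<Longrightarrow> j \<in> {1..k} \<Longrightarrow> i \<noteq> a \<Longrightarrow> j \<noteq> a \<Longrightarrow> i \<noteq> j \<Longrightarrow>
                 block e (Some i) (Some j) = ij"
  shows "(\<Sum>u \<in> pverts (B_graph k). \<Sum>v \<in> pverts (B_graph k). e u v) =
    block e None None + 2 * block e None (Some a) + block e (Some a) (Some a)
    + (real k - 1) * (2 * wi + 2 * ai + ii) + (real k - 1) * (real k - 2) * ij"
proof -
  define R where "R = {1..k} - {a}"
  let ?S = "insert None (insert (Some a) (Some ` R))"
  have R: "finite R" "a \<notin> R" "real (card R) = real k - 1"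
    using a by (auto simp: R_def of_nat_diff)
  have V: "pverts (B_graph k) = (\<Union>s \<in> ?S. strand_verts s)"
    using a by (auto simp: pverts_B_graph_eq R_def strand_verts_def)
  have disjoint: "strand_verts s \<inter> strand_verts t = {}" if "s \<noteq> t" for s t
    using that by (cases s; cases t) (auto simp: strand_verts_def)
  have finite: "finite (strand_verts s)" for s
    by (cases s) (auto simp: strand_verts_def)
  have split: "(\<Sum>u \<in> pverts (B_graph k). g u) = (\<Sum>s \<in> ?S. \<Sum>u \<in> strand_verts s. g u)"
    for g :: "B_vertex \<Rightarrow> real"
    unfolding V using R(1) disjoint finite by (intro sum.UNION_disjoint) auto
  have over_S: "(\<Sum>s \<in> ?S. h s) = h None + h (Some a) + (\<Sum>i \<in> R. h (Some i))"
    for h :: "nat option \<Rightarrow> real"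
    using R(1,2) by (simp add: sum.reindex image_iff add.assoc)
  have "(\<Sum>u \<in> pverts (B_graph k). \<Sum>v \<in> pverts (B_graph k). e u v)
      = (\<Sum>s \<in> ?S. \<Sum>t \<in> ?S. block e s t)"
    unfolding split block_def by (rule sum.cong[OF refl], rule sum.swap)
  moreover have "(\<Sum>i \<in> R. block e (Some i) None) = (real k - 1) * wi"
      "(\<Sum>i \<in> R. block e None (Some i)) = (real k - 1) * wi"
      "(\<Sum>i \<in> R. block e (Some i) (Some a)) = (real k - 1) * ai"
      "(\<Sum>i \<in> R. block e (Some a) (Some i)) = (real k - 1) * ai"
    using W A block_commute[of e, OF sym] R(3) by (simp_all add: R_def)
  moreover have "(\<Sum>j \<in> R. block e (Some i) (Some j)) = ii + (real k - 2) * ij" if "i \<in> R" for i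
  proof -
    have "real (card (R - {i})) = real k - 2"
      using R that by (cases "card R") (auto simp: of_nat_diff)
    then have "(\<Sum>j \<in> R - {i}. block e (Some i) (Some j)) = (real k - 2) * ij"
      using that diff by (simp add: R_def)
    then show ?thesis
      using that same unfolding sum.remove[OF R(1) that] by (simp add: R_def)
  qed
  then have "(\<Sum>i \<in> R. \<Sum>j \<in> R. block e (Some i) (Some j)) = (real k - 1) * (ii + (real k - 2) * ij)"
    using R(3) by simp
  ultimately show ?thesis
    unfolding over_S by (simp add: sum.distrib block_commute[of e "Some a" None, OF sym] algebra_simps)
qed

lemma deleted_dist_commute: "deleted_dist x u v = deleted_dist x v u"
  by (auto simp: deleted_dist_def B_dist_commute)

lemmas block_simps = block_def sum_strand_verts deleted_dist_def B_dist_def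

section \<open>The effect of deleting a vertex\<close>

text \<open>
  The number 330 is twice the Wiener index 165 of a cycle of length 11, namely the one formed by the
  path of the \<open>w\<^sub>j\<close> and strand 1.
\<close>
lemma wiener_index_B_graph:
  assumes "k \<ge> 1"
  shows "wiener_index (with_proj (B_graph k)) = 55 * real k ^ 2 + 75 * real k + 35"
proof -
  \<comment> \<open>A vertex outside \<open>B(k)\<close>, so that its deletion leaves \<open>B(k)\<close> unchanged.\<close>
  let ?x = "PathV (Suc k) 1"
  have "B_minus k ?x = with_proj (B_graph k)"
    by (intro pre_digraph.equality) (auto simp: pre_digraph.del_vert_def B_graph_def symcl_def)
  moreover have "?x \<in> pverts (B_graph (Suc k))" by (auto simp: B_graph_def)
  moreover have "(\<Sum>u \<in> pverts (B_graph k). \<Sum>v \<in> pverts (B_graph k). deleted_dist ?x u v) =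
    330 + (real k - 1) * (2 * 110 + 2 * 110 + 40) + (real k - 1) * (real k - 2) * 110"
    using assms
    by (subst sum_B_graph_by_blocks[OF deleted_dist_commute,
          where a = 1 and wi = 110 and ai = 110 and ii = 40 and ij = 110])
       (simp_all add: block_simps)
  ultimately show ?thesis
    using wiener_index_B_minus[OF assms, of ?x "Suc k"] by (simp add: field_simps power2_eq_square)
qed

text \<open>
  The cycle of length 11 formed with strand 1 becomes a path with 10 vertices, also of Wiener index
  165, and the change comes from the other \<open>k - 1\<close> strands. If an inner vertex \<open>w\<^sub>c\<close> is deleted, only
  their distances to the path of the \<open>w\<^sub>j\<close> matter: the loss of the distances to \<open>w\<^sub>c\<close> outweighs the
  detours. If a hub is deleted, the detours dominate, and paths between different strands get
  longer as well.
\<close>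
lemma wiener_index_B_minus_PathW:
  assumes k: "k \<ge> 1" and c: "c \<in> {0, 1, 2, 3, 4, 5}"
  shows "wiener_index (B_minus k (PathW c)) = wiener_index (with_proj (B_graph k)) +
    (real k - 1) * (if c \<in> {0, 5} then 20 * real k + 15 else if c \<in> {1, 4} then - 5 else - 15)"
proof -
  have x: "PathW c \<in> pverts (B_graph k)" using c by (auto simp: B_graph_def)
  \<comment> \<open>The sums of the distances from one strand \<open>Some i\<close> to the path of the \<open>w\<^sub>j\<close>, and to
    another such strand.\<close>
  define wi ij :: real where
    "wi = (if c \<in> {0, 5} then 125 else if c \<in> {1, 4} then 105 else 95)" and
    "ij = (if c \<in> {0, 5} then 150 else 110)"
  have "(\<Sum>u \<in> pverts (B_graph k). \<Sum>v \<in> pverts (B_graph k). deleted_dist (PathW c) u v) =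
    block (deleted_dist (PathW c)) None None + 2 * block (deleted_dist (PathW c)) None (Some 1)
    + block (deleted_dist (PathW c)) (Some 1) (Some 1)
    + (real k - 1) * (2 * wi + 2 * ij + 40) + (real k - 1) * (real k - 2) * ij"
    using k c
    by (intro sum_B_graph_by_blocks[OF deleted_dist_commute];
        simp only: insert_iff empty_iff simp_thms; elim disjE; simp add: block_simps wi_def ij_def)
  also have "block (deleted_dist (PathW c)) None None + 2 * block (deleted_dist (PathW c)) None (Some 1)
    + block (deleted_dist (PathW c)) (Some 1) (Some 1) = 330"
    using c by (simp only: insert_iff empty_iff simp_thms; elim disjE; simp add: block_simps)
  finally show ?thesis
    unfolding wiener_index_B_minus[OF k x] wiener_index_B_graph[OF k]
    by (auto simp: wi_def ij_def field_simps power2_eq_square split: if_splits)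
qed

text \<open>
  The cycle of length 11 formed with strand \<open>a\<close> again becomes a path of the same Wiener index, and
  distances between vertices outside strand \<open>a\<close> do not change. What remains are the distances between
  strand \<open>a\<close> and the \<open>k - 1\<close> other strands \<open>Some i\<close>. For each of these the sum of the distances is 110
  in \<open>B(k)\<close>, and it is 110 again exactly if an end of strand \<open>a\<close> is deleted.
\<close>
lemma wiener_index_B_minus_PathV:
  assumes a: "a \<in> {1..k}" and c: "c \<in> {1, 2, 3, 4, 5}"
  shows "wiener_index (B_minus k (PathV a c)) = wiener_index (with_proj (B_graph k)) +
    (real k - 1) * (if c \<in> {1, 5} then 0 else if c \<in> {2, 4} then - 15 else - 20)"
proof -
  have k: "k \<ge> 1" using a by simp
  have x: "PathV a c \<in> pverts (B_graph k)" using a c by (auto simp: B_graph_def)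
  \<comment> \<open>The sum of the distances from strand \<open>a\<close> to another strand.\<close>
  define ai :: real where "ai = (if c \<in> {1, 5} then 110 else if c \<in> {2, 4} then 95 else 90)"
  have "(\<Sum>u \<in> pverts (B_graph k). \<Sum>v \<in> pverts (B_graph k). deleted_dist (PathV a c) u v) =
    block (deleted_dist (PathV a c)) None None + 2 * block (deleted_dist (PathV a c)) None (Some a)
    + block (deleted_dist (PathV a c)) (Some a) (Some a)
    + (real k - 1) * (2 * 110 + 2 * ai + 40) + (real k - 1) * (real k - 2) * 110"
    using a c
    by (intro sum_B_graph_by_blocks[OF deleted_dist_commute];
        simp only: insert_iff empty_iff simp_thms; elim disjE; simp add: block_simps ai_def)
  also have "block (deleted_dist (PathV a c)) None None + 2 * block (deleted_dist (PathV a c)) None (Some a)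
    + block (deleted_dist (PathV a c)) (Some a) (Some a) = 330"
    using c by (simp only: insert_iff empty_iff simp_thms; elim disjE; simp add: block_simps)
  finally show ?thesis
    unfolding wiener_index_B_minus[OF k x] wiener_index_B_graph[OF k]
    by (auto simp: ai_def field_simps power2_eq_square split: if_splits)
qed

lemma good_vertex_B_graph_iff:
  assumes "k \<ge> 2"
  shows "good_vertex (with_proj (B_graph k)) x \<longleftrightarrow> (\<exists>i \<in> {1..k}. \<exists>j \<in> {1, 5}. x = PathV i j)"
proof (cases "x \<in> pverts (B_graph k)")
  case True
  have good: "good_vertex (with_proj (B_graph k)) x \<longleftrightarrow>
      wiener_index (with_proj (B_graph k)) = wiener_index (B_minus k x)"
    using True connected_B_minus[of k x k] assms by (simp add: good_vertex_def)
  from True show ?thesis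
  proof (cases rule: B_vertex_cases)
    case (W c)
    have "wiener_index (with_proj (B_graph k)) \<noteq> wiener_index (B_minus k (PathW c))"
      using wiener_index_B_minus_PathW[OF _ W(2), of k] assms by (auto split: if_splits)
    then show ?thesis
      unfolding good by (simp add: W(1))
  next
    case (V a c)
    have "wiener_index (with_proj (B_graph k)) = wiener_index (B_minus k (PathV a c)) \<longleftrightarrow> c \<in> {1, 5}"
      using wiener_index_B_minus_PathV[OF V(2,3)] assms by (auto split: if_splits)
    then show ?thesis
      unfolding good using V(2) by (simp add: V(1))
  qed
next
  case False
  then show ?thesis by (auto simp: good_vertex_def B_graph_def)
qed

theorem theorem1:
  fixes k :: nat
  assumes "k \<ge> 2"
  shows "good_proportion (with_proj (B_graph k)) = 2 * real k / (5 * real k + 6)"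
proof -
  have "{x. good_vertex (with_proj (B_graph k)) x} = (\<lambda>(i, j). PathV i j) ` ({1..k} \<times> {1, 5})"
    unfolding good_vertex_B_graph_iff[OF assms] by auto
  moreover have "card \<dots> = 2 * k"
    by (subst card_image) (auto simp: inj_on_def)
  ultimately show ?thesis
    by (simp add: good_proportion_def card_pverts_B_graph)
qed

end
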